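(* For every $\ell\geq 4$, the graph $A_\ell$ is a minimal non-word-representable graph; that is, $A_\ell$ is not word-representable, and removing any one vertex from $A_\ell$ yields a word-representable graph.
   Context: Two distinct letters $x,y$ alternate in a word $w$ if deleting all letters of $w$ other than the copies of $x$ and $y$ leaves a word $xyxy\cdots$ or $yxyx\cdots$ (of even or odd length). A graph $G=(V,E)$ (finite, simple) is word-representable if there is a word $w$ over the alphabet $V$, containing each letter of $V$, such that for all distinct $x,y\in V$, $x$ and $y$ alternate in $w$ if and only if $xy\in E$. $K^{\triangle}_k$ ($k\geq 3$): the graph obtained from the complete graph on $\{1,\ldots,k\}$ by adding, for each $i\in\{1,\ldots,k-1\}$, a vertex $i'$ adjacent exactly to $i$ and $i+1$, and a vertex $k'$ adjacent exactly to $1$ and $k$. $A_\ell$ ($\ell\geq 4$): the graph obtained from $K^{\triangle}_{\ell-1}$ by adding one new vertex adjacent exactly to the vertices $1,2,\ldots,\ell-1$ of its clique. *)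

theory Defs
  imports "Graph_Theory.Graph_Theory"
begin

definition alternating_word :: "'a \<Rightarrow> 'a \<Rightarrow> nat \<Rightarrow> 'a list" where
  "alternating_word x y n = map (\<lambda>i. if even i then x else y) [0..<n]"

definition alternate :: "'a \<Rightarrow> 'a \<Rightarrow> 'a list \<Rightarrow> bool" where
  "alternate x y w \<longleftrightarrow> x \<noteq> y \<and>
     (\<exists>n. filter (\<lambda>z. z = x \<or> z = y) w = alternating_word x y n \<or>
          filter (\<lambda>z. z = x \<or> z = y) w = alternating_word y x n)"

(* Simple graphs are symmetric loop-free digraphs, so that xy is an edge iff x dominates y.
   The notion is only meant for digraphs satisfying the library predicate graph. *)
definition word_representable :: "('a, 'b) pre_digraph \<Rightarrow> bool" where
  "word_representable G \<longleftrightarrow>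
     (\<exists>w. set w = verts G \<and>
          (\<forall>x\<in>verts G. \<forall>y\<in>verts G. x \<noteq> y \<longrightarrow> (alternate x y w \<longleftrightarrow> x \<rightarrow>\<^bsub>G\<^esub> y)))"

definition minimal_non_word_representable :: "('a, 'b) pre_digraph \<Rightarrow> bool" where
  "minimal_non_word_representable G \<longleftrightarrow>
     \<not> word_representable G \<and>
     (\<forall>v\<in>verts G. word_representable (pre_digraph.del_vert G v))"

(* Clique i is the vertex i, Outer i is the vertex i', and Apex is the vertex that A adds. *)
datatype vertex = Clique nat | Outer nat | Apex

definition K_triangle :: "nat \<Rightarrow> vertex pair_pre_digraph" where
  "K_triangle k =
     (let E = {(Outer i, Clique i) | i. i \<in> {1..k-1}}
            \<union> {(Outer i, Clique (i + 1)) | i. i \<in> {1..k-1}}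
            \<union> {(Outer k, Clique 1), (Outer k, Clique k)}
      in \<lparr> pverts = Clique ` {1..k} \<union> Outer ` {1..k},
           parcs = {(Clique i, Clique j) | i j. i \<in> {1..k} \<and> j \<in> {1..k} \<and> i \<noteq> j}
                 \<union> E \<union> E\<inverse> \<rparr>)"

definition add_vertex :: "'a \<Rightarrow> 'a set \<Rightarrow> 'a pair_pre_digraph \<Rightarrow> 'a pair_pre_digraph" where
  "add_vertex v N G =
     \<lparr> pverts = insert v (pverts G), parcs = parcs G \<union> {v} \<times> N \<union> N \<times> {v} \<rparr>"

definition A_graph :: "nat \<Rightarrow> vertex pair_pre_digraph" where
  "A_graph l = add_vertex Apex (Clique ` {1..l-1}) (K_triangle (l - 1))"

lemma pair_graph_K_triangle:
  assumes "k \<ge> 3"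
  shows "pair_graph (K_triangle k)"
proof -
  have fin: "finite (pverts (K_triangle k))"
    by (simp add: K_triangle_def Let_def)
  have sub: "parcs (K_triangle k) \<subseteq> pverts (K_triangle k) \<times> pverts (K_triangle k)"
    using assms by (auto simp: K_triangle_def Let_def)
  have "sym (parcs (K_triangle k))"
    by (auto simp: K_triangle_def Let_def sym_def)
  moreover have "fst e \<noteq> snd e" if "e \<in> parcs (K_triangle k)" for e
    using that by (auto simp: K_triangle_def Let_def)
  ultimately show ?thesis
    using sub finite_subset[OF sub finite_cartesian_product[OF fin fin]] fin
    by unfold_locales (auto simp: symmetric_def)
qed

lemma pair_graph_add_vertex:
  assumes "pair_graph G" "v \<notin> pverts G" "N \<subseteq> pverts G"
  shows "pair_graph (add_vertex v N G)"
proof -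
  interpret pair_graph G by fact
  have "sym (parcs G)"
    using pair_sym_arcs by (simp add: symmetric_def)
  then have "sym (parcs (add_vertex v N G))"
    by (auto simp: add_vertex_def sym_def)
  moreover have "finite N"
    using assms(3) pair_finite_verts finite_subset by blast
  ultimately show ?thesis
    using assms(2,3) pair_finite_verts pair_finite_arcs
    by unfold_locales
      (auto simp: add_vertex_def symmetric_def dest: in_arcsD1 in_arcsD2 no_loops')
qed

lemma pair_graph_A_graph:
  assumes "l \<ge> 4"
  shows "pair_graph (A_graph l)"
  unfolding A_graph_def
  by (rule pair_graph_add_vertex[OF pair_graph_K_triangle])
    (use assms in \<open>auto simp: K_triangle_def Let_def\<close>)

end

theory Submission
  imports Defs "HOL-Library.Sublist"
begin

text \<open>Two letters alternate iff one of them leads the other: in every prefix it occurs as often or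
  once more. In a representing word the clique together with the apex is therefore cyclically
  ordered, and an outer vertex, having only two neighbours there, forces these to be cyclically
  consecutive. The clique vertex that follows the apex would have both of its neighbours on the
  clique cycle next to it, although one side is taken by the apex.

  For minimality, deleting the apex leaves \<open>K_triangle\<close>, for which a word is written down
  explicitly. Deleting any other vertex breaks the cycle of outer vertices, so the apex can be
  placed in the gap: the rest is an induced subgraph of a larger \<open>K_triangle\<close>.\<close>

section \<open>Alternation in terms of prefix counts\<close>

text \<open>Prefix counts turn alternation into linear inequalities, and the argument order records
  which letter comes first. For distinct letters both directions hold at once only if neither occurs
  in the word.\<close>

definition leads :: "'a \<Rightarrow> 'a \<Rightarrow> 'a list \<Rightarrow> bool" where
  "leads x y w \<longleftrightarrow>
     (\<forall>u. prefix u w \<longrightarrow> count_list u y \<le> count_list u x \<and> count_list u x \<le> Suc (count_list u y))"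

lemma leads_refl: "leads x x w"
  by (simp add: leads_def)

lemma leads_snoc:
  "leads x y (w @ [z]) \<longleftrightarrow> leads x y w \<and>
     count_list (w @ [z]) y \<le> count_list (w @ [z]) x \<and>
     count_list (w @ [z]) x \<le> Suc (count_list (w @ [z]) y)"
  unfolding leads_def by (auto simp: prefix_snoc)

lemma alternating_word_Suc:
  "alternating_word x y (Suc n) = alternating_word x y n @ [if even n then x else y]"
  by (simp add: alternating_word_def)

lemma count_list_alternating_word:
  assumes "x \<noteq> y"
  shows "count_list (alternating_word x y n) x = (n + 1) div 2"
    and "count_list (alternating_word x y n) y = n div 2"
proof (induction n)
  case 0
  show "count_list (alternating_word x y 0) x = (0 + 1) div 2"
    and "count_list (alternating_word x y 0) y = 0 div 2"
    by (simp_all add: alternating_word_def)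
next
  case (Suc n)
  show "count_list (alternating_word x y (Suc n)) x = (Suc n + 1) div 2"
    and "count_list (alternating_word x y (Suc n)) y = Suc n div 2"
    using Suc assms by (auto simp: alternating_word_Suc elim!: evenE oddE)
qed

lemma count_list_filter:
  "P x \<Longrightarrow> count_list (filter P w) x = count_list w x"
  by (induction w) auto

text \<open>The counts \<open>(n + 1) div 2\<close> and \<open>n div 2\<close> of an alternating
  word of length \<open>n\<close> leave the two bounds of \<open>leads\<close> room for exactly one
  next letter, the one given by the parity of \<open>n\<close>.\<close>

lemma alternating_filter_iff_leads:
  assumes "x \<noteq> y"
  shows "(\<exists>n. filter (\<lambda>z. z = x \<or> z = y) w = alternating_word x y n) \<longleftrightarrow> leads x y w"
proof (induction w rule: rev_induct)
  case Nil
  have "[] = alternating_word x y 0"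
    by (simp add: alternating_word_def)
  then show ?case
    by (auto simp: leads_def)
next
  case (snoc z w)
  let ?F = "filter (\<lambda>z. z = x \<or> z = y)"
  have step: "(\<exists>n. ?F w @ [z] = alternating_word x y n) \<longleftrightarrow>
      (\<exists>n. ?F w = alternating_word x y n \<and> z = (if even n then x else y))"
  proof
    assume "\<exists>n. ?F w @ [z] = alternating_word x y n"
    then obtain n where n: "?F w @ [z] = alternating_word x y n" ..
    then obtain k where "n = Suc k"
      by (cases n) (auto simp: alternating_word_def)
    with n show "\<exists>n. ?F w = alternating_word x y n \<and> z = (if even n then x else y)"
      by (auto simp: alternating_word_Suc)
  next
    assume "\<exists>n. ?F w = alternating_word x y n \<and> z = (if even n then x else y)"
    then obtain n where "?F w @ [z] = alternating_word x y (Suc n)"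
      by (auto simp: alternating_word_Suc)
    then show "\<exists>n. ?F w @ [z] = alternating_word x y n" ..
  qed
  have counts: "count_list w x = (n + 1) div 2 \<and> count_list w y = n div 2"
    if "?F w = alternating_word x y n" for n
    using count_list_filter[of "\<lambda>z. z = x \<or> z = y" x w]
      count_list_filter[of "\<lambda>z. z = x \<or> z = y" y w]
      count_list_alternating_word[OF assms, of n] that by simp
  show ?case
  proof (cases "z = x \<or> z = y")
    case False
    then show ?thesis
      using snoc by (auto simp: leads_snoc) (auto simp: leads_def)
  next
    case True
    have "(\<exists>n. ?F w = alternating_word x y n \<and> z = (if even n then x else y)) \<longleftrightarrow>
      leads x y (w @ [z])" (is "?L \<longleftrightarrow> ?R")
    proof
      assume ?L
      then obtain n where n: "?F w = alternating_word x y n" "z = (if even n then x else y)"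
        by blast
      have "leads x y w"
        using n snoc by blast
      then show ?R
        using counts[OF n(1)] n(2) assms by (auto simp: leads_snoc elim!: evenE oddE)
    next
      assume R: ?R
      then obtain n where n: "?F w = alternating_word x y n"
        using snoc by (auto simp: leads_snoc)
      have "z = (if even n then x else y)"
        using counts[OF n] R True assms by (auto simp: leads_snoc elim!: evenE oddE)
      with n show ?L by blast
    qed
    with True step show ?thesis by simp
  qed
qed

lemma alternate_iff_leads:
  "alternate x y w \<longleftrightarrow> x \<noteq> y \<and> (leads x y w \<or> leads y x w)"
proof -
  have "filter (\<lambda>z. z = x \<or> z = y) w = filter (\<lambda>z. z = y \<or> z = x) w"
    by (rule filter_cong) auto
  then show ?thesis
    unfolding alternate_def
    using alternating_filter_iff_leads[of x y w] alternating_filter_iff_leads[of y x w] by metis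
qed

section \<open>Induced subgraphs\<close>

lemma map_alternating_word: "map h (alternating_word x y n) = alternating_word (h x) (h y) n"
  by (simp add: alternating_word_def)

text \<open>Alternation depends only on the projection of the word to the two letters, which
  survives deletion of other letters and injective renaming.\<close>

lemma alternate_map_filter:
  assumes inj: "inj_on h V" and "x \<in> V" "y \<in> V"
  shows "alternate x y (map (inv_into V h) (filter (\<lambda>z. z \<in> h ` V) w)) \<longleftrightarrow>
    alternate (h x) (h y) w"
proof -
  let ?g = "inv_into V h" and ?F = "filter (\<lambda>z. z = h x \<or> z = h y) w"
  have 1: "filter (\<lambda>z. z = x \<or> z = y) (map ?g (filter (\<lambda>z. z \<in> h ` V) w)) = map ?g ?F"
    using assms by (induction w) auto
  have 2: "map ?g ?F = alternating_word a b n \<longleftrightarrow> ?F = alternating_word (h a) (h b) n"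
    if "a \<in> V" "b \<in> V" for a b n
  proof -
    have hg: "map h (map ?g ?F) = ?F"
      unfolding map_map using assms by (intro map_idI) auto
    have gh: "map ?g (alternating_word (h a) (h b) n) = alternating_word a b n"
      using that inj by (simp add: map_alternating_word)
    show ?thesis
    proof
      assume "map ?g ?F = alternating_word a b n"
      then have "map h (map ?g ?F) = map h (alternating_word a b n)"
        by (rule arg_cong)
      then show "?F = alternating_word (h a) (h b) n"
        by (simp only: hg map_alternating_word)
    next
      assume "?F = alternating_word (h a) (h b) n"
      then show "map ?g ?F = alternating_word a b n"
        by (simp only: gh)
    qed
  qed
  have 3: "x \<noteq> y \<longleftrightarrow> h x \<noteq> h y"
    using assms by (auto dest: inj_onD)
  show ?thesis
    unfolding alternate_def 1 2[OF assms(2,3)] 2[OF assms(3,2)] 3 ..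
qed

text \<open>Restricting a word for \<open>G\<close> to the image of \<open>h\<close> and renaming
  back keeps every alternation, so representability is inherited by induced subgraphs.\<close>

lemma word_representable_embed:
  assumes "word_representable G"
    and inj: "inj_on h (verts H)" and sub: "h ` verts H \<subseteq> verts G"
    and adj: "\<And>x y. \<lbrakk>x \<in> verts H; y \<in> verts H; x \<noteq> y\<rbrakk> \<Longrightarrow> x \<rightarrow>\<^bsub>H\<^esub> y \<longleftrightarrow> h x \<rightarrow>\<^bsub>G\<^esub> h y"
  shows "word_representable H"
proof -
  obtain w where w: "set w = verts G"
    "\<And>x y. \<lbrakk>x \<in> verts G; y \<in> verts G; x \<noteq> y\<rbrakk> \<Longrightarrow> alternate x y w \<longleftrightarrow> x \<rightarrow>\<^bsub>G\<^esub> y"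
    using assms(1) unfolding word_representable_def by blast
  let ?w = "map (inv_into (verts H) h) (filter (\<lambda>z. z \<in> h ` verts H) w)"
  have "set (filter (\<lambda>z. z \<in> h ` verts H) w) = h ` verts H"
    using w(1) sub by auto
  then have "set ?w = verts H"
    unfolding set_map using inv_into_image_cancel[OF inj subset_refl] by (simp only:)
  moreover have "alternate x y ?w \<longleftrightarrow> x \<rightarrow>\<^bsub>H\<^esub> y"
    if "x \<in> verts H" "y \<in> verts H" "x \<noteq> y" for x y
  proof -
    have "h x \<in> verts G" "h y \<in> verts G" "h x \<noteq> h y"
      using that sub inj by (auto dest: inj_onD)
    then show ?thesis
      using w(2)[of "h x" "h y"] adj[OF that] alternate_map_filter[OF inj that(1,2), of w] by blast
  qed
  ultimately show ?thesis
    unfolding word_representable_def by blast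
qed

section \<open>Words given by occurrence times\<close>

text \<open>\<open>p x n\<close> is read as the time of occurrence number \<open>n\<close> of
  \<open>x\<close>, counted from 0, with \<open>m\<close> occurrences per letter; the times of
  \<open>x\<close> and \<open>y\<close> then merge into the pattern xyxy...\<close>

definition interleave :: "('a \<Rightarrow> nat \<Rightarrow> nat) \<Rightarrow> nat \<Rightarrow> 'a \<Rightarrow> 'a \<Rightarrow> bool" where
  "interleave p m x y \<longleftrightarrow>
     (\<forall>n<m. p x n < p y n) \<and> (\<forall>n. Suc n < m \<longrightarrow> p y n < p x (Suc n))"

lemma prefix_concat_singletons:
  assumes "\<And>s. length (f s) \<le> 1"
  shows "prefix u (concat (map f [0..<T])) \<longleftrightarrow> (\<exists>s\<le>T. u = concat (map f [0..<s]))"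
proof (induction T)
  case 0
  show ?case by simp
next
  case (Suc T)
  show ?case
  proof (cases "f T")
    case Nil
    then show ?thesis
      using Suc by (auto simp: le_Suc_eq)
  next
    case (Cons a l)
    with assms[of T] have "f T = [a]" by simp
    then show ?thesis
      using Suc by (auto simp: le_Suc_eq prefix_snoc)
  qed
qed

text \<open>Writing the letters in the order of their times reduces alternation to inequalities
  between numbers, so a word can be given by formulas for the times.\<close>

lemma word_of_times:
  fixes p :: "'a \<Rightarrow> nat \<Rightarrow> nat"
  assumes fin: "finite V" and "m > 0"
    and inj: "\<And>x y i j. \<lbrakk>x \<in> V; y \<in> V; i < m; j < m; p x i = p y j\<rbrakk> \<Longrightarrow> x = y"
    and mono: "\<And>x i. \<lbrakk>x \<in> V; Suc i < m\<rbrakk> \<Longrightarrow> p x i < p x (Suc i)"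
  obtains w where "set w = V"
    and "\<And>x y. \<lbrakk>x \<in> V; y \<in> V\<rbrakk> \<Longrightarrow> leads x y w \<longleftrightarrow> x = y \<or> interleave p m x y"
proof -
  have mono_less: "p x i < p x j" if "x \<in> V" "i < j" "j < m" for x i j
    using that(2,3)
  proof (induction j)
    case (Suc j)
    then show ?case
      using mono[OF that(1), of j] by (cases "i = j") auto
  qed simp
  \<comment> \<open>\<open>T\<close> exceeds every occurrence time, so \<open>W T\<close> below is
    the whole word; the inserted 0 covers empty \<open>V\<close>.\<close>
  define T where "T = Suc (Max (insert 0 ((\<lambda>(x, n). p x n) ` (V \<times> {..<m}))))"
  have T: "p x n < T" if "x \<in> V" "n < m" for x n
  proof -
    have "p x n \<le> Max (insert 0 ((\<lambda>(x, n). p x n) ` (V \<times> {..<m})))"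
      using that fin by (intro Max_ge) auto
    then show ?thesis by (simp add: T_def)
  qed
  \<comment> \<open>By \<open>inj\<close> a time slot holds at most one letter, so the prefixes of
    the word correspond to cut-off times.\<close>
  define f where "f s = (if \<exists>x\<in>V. \<exists>n<m. p x n = s then [SOME x. x \<in> V \<and> (\<exists>n<m. p x n = s)] else [])"
    for s
  have f_eq: "f (p x n) = [x]" if "x \<in> V" "n < m" for x n
  proof -
    have "(SOME z. z \<in> V \<and> (\<exists>i<m. p z i = p x n)) = x"
      using that inj by (intro some_equality) blast+
    then show ?thesis
      using that by (auto simp: f_def)
  qed
  have f_mem: "x \<in> V \<and> (\<exists>n<m. p x n = s)" if "x \<in> set (f s)" for x s
  proof -
    have ex: "\<exists>x\<in>V. \<exists>n<m. p x n = s"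
      using that by (auto simp: f_def split: if_splits)
    then show ?thesis
      using that f_eq by auto
  qed
  have f_len: "length (f s) \<le> 1" for s
    by (simp add: f_def)
  define W where "W s = concat (map f [0..<s])" for s
  have count_f: "count_list (f s) x = (if \<exists>n<m. p x n = s then 1 else 0)" if "x \<in> V" for x s
  proof (cases "\<exists>n<m. p x n = s")
    case True
    then show ?thesis using f_eq that by auto
  next
    case False
    then have "x \<notin> set (f s)" using f_mem by blast
    then show ?thesis using False by (simp add: count_notin)
  qed
  \<comment> \<open>The times of a letter increase, so the indices of those before \<open>s\<close>
    form an initial segment and can be compared with the count.\<close>
  have count_W: "n < count_list (W s) x \<longleftrightarrow> n < m \<and> p x n < s" if x: "x \<in> V" for x n s
  proof -
    have card_eq: "card {n. n < m \<and> p x n = s} = (if \<exists>n<m. p x n = s then 1 else 0)" for s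
    proof (cases "\<exists>n<m. p x n = s")
      case True
      then obtain n where n: "n < m" "p x n = s" by blast
      have "k = n" if "k < m" "p x k = s" for k
        using mono_less[OF x, of k n] mono_less[OF x, of n k] n that by (cases k n rule: linorder_cases) auto
      with n have "{n. n < m \<and> p x n = s} = {n}" by blast
      with True show ?thesis by simp
    next
      case False
      then have "{n. n < m \<and> p x n = s} = {}" by blast
      with False show ?thesis by (simp only: card.empty if_False)
    qed
    have card_Suc: "card {n. n < m \<and> p x n < Suc s} =
        card {n. n < m \<and> p x n < s} + (if \<exists>n<m. p x n = s then 1 else 0)" for s
    proof -
      have "{n. n < m \<and> p x n < Suc s} = {n. n < m \<and> p x n < s} \<union> {n. n < m \<and> p x n = s}"
        by auto
      moreover have "{n. n < m \<and> p x n < s} \<inter> {n. n < m \<and> p x n = s} = {}"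
        by auto
      ultimately show ?thesis
        using card_eq[of s] by (simp add: card_Un_disjoint del: Collect_disj_eq)
    qed
    have cnt: "count_list (W s) x = card {n. n < m \<and> p x n < s}" for s
    proof (induction s)
      case 0
      show ?case by (simp add: W_def)
    next
      case (Suc s)
      have "W (Suc s) = W s @ f s" by (simp add: W_def)
      then show ?case
        using Suc count_f[OF x] card_Suc[of s] by simp
    qed
    show ?thesis
    proof
      assume "n < count_list (W s) x"
      then have less: "n < card {n. n < m \<and> p x n < s}" by (simp add: cnt)
      show "n < m \<and> p x n < s"
      proof (rule ccontr)
        assume *: "\<not> (n < m \<and> p x n < s)"
        have "{n. n < m \<and> p x n < s} \<subseteq> {..<n}"
        proof
          fix k assume k: "k \<in> {n. n < m \<and> p x n < s}"
          show "k \<in> {..<n}"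
          proof (rule ccontr)
            assume "k \<notin> {..<n}"
            with k * mono_less[OF x, of n k] show False
              by (cases "n = k") auto
          qed
        qed
        then have "card {n. n < m \<and> p x n < s} \<le> n"
          by (metis card_lessThan card_mono finite_lessThan)
        with less show False by simp
      qed
    next
      assume *: "n < m \<and> p x n < s"
      have "{..n} \<subseteq> {n. n < m \<and> p x n < s}"
      proof
        fix k assume "k \<in> {..n}"
        then show "k \<in> {n. n < m \<and> p x n < s}"
          using * mono_less[OF x, of k n] by (cases "k = n") auto
      qed
      then have "card {..n} \<le> card {n. n < m \<and> p x n < s}"
        by (intro card_mono) auto
      then show "n < count_list (W s) x" by (simp add: cnt)
    qed
  qed
  have set_W: "set (W T) = V"
  proof
    show "set (W T) \<subseteq> V" using f_mem by (auto simp: W_def)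
    show "V \<subseteq> set (W T)"
    proof
      fix x assume x: "x \<in> V"
      then have "0 < count_list (W T) x"
        using count_W[of x 0 T] T \<open>m > 0\<close> by simp
      then show "x \<in> set (W T)"
        using count_notin by fastforce
    qed
  qed
  have "leads x y (W T) \<longleftrightarrow> x = y \<or> interleave p m x y" if x: "x \<in> V" and y: "y \<in> V" for x y
  proof (cases "x = y")
    case True
    then show ?thesis by (simp add: leads_refl)
  next
    case False
    have "leads x y (W T) \<longleftrightarrow>
        (\<forall>s\<le>T. count_list (W s) y \<le> count_list (W s) x \<and>
               count_list (W s) x \<le> Suc (count_list (W s) y))"
      unfolding leads_def using prefix_concat_singletons[of f, OF f_len] by (auto simp: W_def)
    also have "\<dots> \<longleftrightarrow> interleave p m x y"
    proof
      assume L: "\<forall>s\<le>T. count_list (W s) y \<le> count_list (W s) x \<and>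
               count_list (W s) x \<le> Suc (count_list (W s) y)"
      have "p x n < p y n" if n: "n < m" for n
      proof -
        \<comment> \<open>Cut just after occurrence \<open>n\<close> of \<open>y\<close>:
          \<open>y\<close> then has more than \<open>n\<close> copies, and so must
          \<open>x\<close>.\<close>
        have "n < count_list (W (Suc (p y n))) y"
          using count_W[OF y] n by simp
        also have "\<dots> \<le> count_list (W (Suc (p y n))) x"
          using L T[OF y n] by simp
        finally have "p x n \<le> p y n"
          using count_W[OF x] by simp
        moreover have "p x n \<noteq> p y n"
          using inj[OF x y n n] False by blast
        ultimately show ?thesis by simp
      qed
      moreover have "p y n < p x (Suc n)" if n: "Suc n < m" for n
      proof -
        have "Suc n < count_list (W (Suc (p x (Suc n)))) x"
          using count_W[OF x] n by simp
        also have "\<dots> \<le> Suc (count_list (W (Suc (p x (Suc n)))) y)"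
          using L T[OF x n] by simp
        finally have "p y n \<le> p x (Suc n)"
          using count_W[OF y] by simp
        moreover have "p y n \<noteq> p x (Suc n)"
          using inj[OF x y n, of n] n False by fastforce
        ultimately show ?thesis by simp
      qed
      ultimately show "interleave p m x y"
        by (simp add: interleave_def)
    next
      assume I: "interleave p m x y"
      show "\<forall>s\<le>T. count_list (W s) y \<le> count_list (W s) x \<and>
               count_list (W s) x \<le> Suc (count_list (W s) y)"
      proof (intro allI impI conjI)
        fix s
        have "\<And>n. n < count_list (W s) y \<Longrightarrow> n < count_list (W s) x"
          using I count_W[OF x] count_W[OF y] unfolding interleave_def
          by (meson less_trans)
        then show "count_list (W s) y \<le> count_list (W s) x"
          by (meson leI less_irrefl)
        have "\<And>n. Suc n < count_list (W s) x \<Longrightarrow> n < count_list (W s) y"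
          using I count_W[OF x] count_W[OF y] unfolding interleave_def
          by (meson Suc_lessD less_trans)
        then show "count_list (W s) x \<le> Suc (count_list (W s) y)"
          by (meson not_less_eq_eq less_irrefl not_le)
      qed
    qed
    finally show ?thesis using False by simp
  qed
  with set_W show thesis using that by blast
qed

section \<open>Adjacency in the two graph families\<close>

text \<open>With the cyclic successor the exceptional vertex k' obeys the general rule:
  \<open>Outer i\<close> is adjacent to \<open>Clique i\<close> and to the next clique
  vertex.\<close>

abbreviation cyc_suc :: "nat \<Rightarrow> nat \<Rightarrow> nat" where
  "cyc_suc k i \<equiv> (if i = k then 1 else Suc i)"

lemma pverts_K_triangle: "pverts (K_triangle k) = Clique ` {1..k} \<union> Outer ` {1..k}"
  by (simp add: K_triangle_def Let_def)

lemma parcs_K_triangle: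
  "(Clique i, Clique j) \<in> parcs (K_triangle k) \<longleftrightarrow> i \<in> {1..k} \<and> j \<in> {1..k} \<and> i \<noteq> j"
  "k \<ge> 1 \<Longrightarrow> (Outer i, Clique j) \<in> parcs (K_triangle k) \<longleftrightarrow>
    i \<in> {1..k} \<and> (j = i \<or> j = cyc_suc k i)"
  "k \<ge> 1 \<Longrightarrow> (Clique j, Outer i) \<in> parcs (K_triangle k) \<longleftrightarrow>
    i \<in> {1..k} \<and> (j = i \<or> j = cyc_suc k i)"
  "(Outer i, Outer j) \<notin> parcs (K_triangle k)"
  "(Apex, v) \<notin> parcs (K_triangle k)"
  "(v, Apex) \<notin> parcs (K_triangle k)"
  by (auto simp: K_triangle_def Let_def)

lemma pverts_A_graph: "pverts (A_graph (Suc k)) = insert Apex (pverts (K_triangle k))"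
  by (simp add: A_graph_def add_vertex_def)

lemma parcs_A_graph:
  "(Clique i, Clique j) \<in> parcs (A_graph (Suc k)) \<longleftrightarrow> i \<in> {1..k} \<and> j \<in> {1..k} \<and> i \<noteq> j"
  "k \<ge> 1 \<Longrightarrow> (Outer i, Clique j) \<in> parcs (A_graph (Suc k)) \<longleftrightarrow>
    i \<in> {1..k} \<and> (j = i \<or> j = cyc_suc k i)"
  "k \<ge> 1 \<Longrightarrow> (Clique j, Outer i) \<in> parcs (A_graph (Suc k)) \<longleftrightarrow>
    i \<in> {1..k} \<and> (j = i \<or> j = cyc_suc k i)"
  "(Outer i, Outer j) \<notin> parcs (A_graph (Suc k))"
  "(Apex, Clique i) \<in> parcs (A_graph (Suc k)) \<longleftrightarrow> i \<in> {1..k}"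
  "(Clique i, Apex) \<in> parcs (A_graph (Suc k)) \<longleftrightarrow> i \<in> {1..k}"
  "(Apex, Outer i) \<notin> parcs (A_graph (Suc k))"
  "(Outer i, Apex) \<notin> parcs (A_graph (Suc k))"
  "(Apex, Apex) \<notin> parcs (A_graph (Suc k))"
  by (auto simp: A_graph_def add_vertex_def parcs_K_triangle)

lemma del_vert_dominates:
  "x \<rightarrow>\<^bsub>pre_digraph.del_vert (with_proj G) v\<^esub> y \<longleftrightarrow> (x, y) \<in> parcs G \<and> x \<noteq> v \<and> y \<noteq> v"
  by (auto simp: arcs_ends_conv pre_digraph.del_vert_def image_iff)

section \<open>Non-representability\<close>

text \<open>\<open>leads\<close> alone is not transitive, as the counts of \<open>x\<close> and
  \<open>z\<close> may differ by 2. Alternation of \<open>x\<close> and \<open>z\<close> excludes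
  this: if \<open>z\<close> leads \<open>x\<close>, all three counts agree in every prefix.\<close>

lemma leads_total_trans:
  assumes "leads x y w" "leads y z w" "leads x z w \<or> leads z x w"
  shows "leads x z w"
  using assms unfolding leads_def by (meson le_trans)

text \<open>Along four letters of a clique in cyclic order, a further letter that alternates with two
  opposite ones alternates with one of the other two.\<close>

lemma crossing:
  assumes "leads a b w" "leads b c w" "leads c d w" "leads a d w"
  shows "\<lbrakk>leads v a w \<or> leads a v w; leads v c w \<or> leads c v w\<rbrakk> \<Longrightarrow>
      (leads v b w \<or> leads b v w) \<or> (leads v d w \<or> leads d v w)" (is "\<lbrakk>?A; ?C\<rbrakk> \<Longrightarrow> ?B \<or> ?D")
    and "\<lbrakk>leads v b w \<or> leads b v w; leads v d w \<or> leads d v w\<rbrakk> \<Longrightarrow>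
      (leads v a w \<or> leads a v w) \<or> (leads v c w \<or> leads c v w)"
proof -
  let ?n = "\<lambda>u x. count_list u x"
  have chain: "?n u b \<le> ?n u a" "?n u c \<le> ?n u b" "?n u d \<le> ?n u c" "?n u a \<le> Suc (?n u d)"
    if "prefix u w" for u
    using assms that by (auto simp: leads_def)
  \<comment> \<open>Claims about \<open>leads\<close> are reduced to a single prefix, where only
    linear inequalities between counts remain.\<close>
  have I: "leads x y w"
    if "leads p q w" "leads r s w"
      and "\<And>u. \<lbrakk>?n u q \<le> ?n u p; ?n u p \<le> Suc (?n u q); ?n u s \<le> ?n u r; ?n u r \<le> Suc (?n u s);
          ?n u b \<le> ?n u a; ?n u c \<le> ?n u b; ?n u d \<le> ?n u c; ?n u a \<le> Suc (?n u d)\<rbrakk>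
        \<Longrightarrow> ?n u y \<le> ?n u x \<and> ?n u x \<le> Suc (?n u y)" for p q r s x y
    unfolding leads_def using that(1,2) that(3)[OF _ _ _ _ chain] by (simp add: leads_def)
  \<comment> \<open>The four cases are the four combinations of directions between \<open>v\<close>
    and each of \<open>a\<close> and \<open>c\<close>.\<close>
  have "leads v b w" if "leads v a w" "leads v c w"
    by (rule I[OF that]) (intro conjI; linarith)
  moreover have "leads b v w" if "leads a v w" "leads c v w"
    by (rule I[OF that]) (intro conjI; linarith)
  moreover have "leads v d w" if "leads a v w" "leads v c w"
    by (rule I[OF that]) (intro conjI; linarith)
  moreover have "leads v b w" if "leads v a w" "leads c v w"
    by (rule I[OF that]) (intro conjI; linarith)
  ultimately show "\<lbrakk>?A; ?C\<rbrakk> \<Longrightarrow> ?B \<or> ?D"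
    by blast
  have "leads v c w" if "leads v b w" "leads v d w"
    by (rule I[OF that]) (intro conjI; linarith)
  moreover have "leads c v w" if "leads b v w" "leads d v w"
    by (rule I[OF that]) (intro conjI; linarith)
  moreover have "leads a v w" if "leads b v w" "leads v d w"
    by (rule I[OF that]) (intro conjI; linarith)
  moreover have "leads v c w" if "leads v b w" "leads d v w"
    by (rule I[OF that]) (intro conjI; linarith)
  ultimately show "\<lbrakk>?B; ?D\<rbrakk> \<Longrightarrow> ?A \<or> ?C"
    by blast
qed

text \<open>Applied to \<open>leads\<close> on a set of clique vertices, a total preorder, to find
  where the cyclic order continues after the apex.\<close>

lemma finite_total_trans_least:
  assumes "finite S" "S \<noteq> {}"
    and "\<And>x y. \<lbrakk>x \<in> S; y \<in> S\<rbrakk> \<Longrightarrow> R x y \<or> R y x"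
    and "\<And>x y z. \<lbrakk>x \<in> S; y \<in> S; z \<in> S; R x y; R y z\<rbrakk> \<Longrightarrow> R x z"
  shows "\<exists>m\<in>S. \<forall>x\<in>S. R m x"
  using assms
proof (induction S rule: finite_ne_induct)
  case (singleton x)
  have "R x x"
    using singleton(1)[of x x] by simp
  then show ?case by simp
next
  case (insert x F)
  have "\<exists>m\<in>F. \<forall>x\<in>F. R m x"
  proof (rule insert.IH)
    fix y z assume "y \<in> F" "z \<in> F"
    then show "R y z \<or> R z y" using insert.prems(1)[of y z] by simp
  next
    fix y z u assume "y \<in> F" "z \<in> F" "u \<in> F" "R y z" "R z u"
    then show "R y u" using insert.prems(2)[of y z u] by simp
  qed
  then obtain m where m: "m \<in> F" "\<forall>x\<in>F. R m x" ..
  have "R x x"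
    using insert.prems(1)[of x x] by simp
  show ?case
  proof (cases "R m x")
    case True
    with m show ?thesis by blast
  next
    case False
    then have "R x m"
      using insert.prems(1)[of x m] m(1) by simp
    then have "R x y" if "y \<in> F" for y
      using insert.prems(2)[of x m y] m that by simp
    with \<open>R x x\<close> show ?thesis by simp
  qed
qed

lemma not_word_representable_A_graph:
  assumes k: "k \<ge> 3"
  shows "\<not> word_representable (with_proj (A_graph (Suc k)))"
proof
  let ?G = "A_graph (Suc k)"
  define C where "C = Clique ` {1..k}"
  assume "word_representable (with_proj ?G)"
  then obtain w where "\<forall>x\<in>pverts ?G. \<forall>y\<in>pverts ?G. x \<noteq> y \<longrightarrow>
      (alternate x y w \<longleftrightarrow> (x, y) \<in> parcs ?G)"
    unfolding word_representable_def by auto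
  then have w: "(leads x y w \<or> leads y x w) \<longleftrightarrow> (x, y) \<in> parcs ?G"
    if "x \<in> pverts ?G" "y \<in> pverts ?G" "x \<noteq> y" for x y
    using that by (auto simp: alternate_iff_leads)
  have total: "leads x y w \<or> leads y x w" if "x \<in> insert Apex C" "y \<in> insert Apex C" for x y
    using w[of x y] that leads_refl[of x w]
    by (cases "x = y") (auto simp: C_def pverts_A_graph pverts_K_triangle parcs_A_graph)
  have trans: "leads x z w"
    if "x \<in> insert Apex C" "y \<in> insert Apex C" "z \<in> insert Apex C" "leads x y w" "leads y z w" for x y z
    using leads_total_trans[OF that(4,5)] total that(1,3) by blast
  have least: "\<exists>m\<in>S. \<forall>x\<in>S. leads m x w" if "S \<subseteq> C" "S \<noteq> {}" for S
  proof (rule finite_total_trans_least)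
    show "finite S" by (rule finite_subset[OF that(1)]) (simp add: C_def)
    show "S \<noteq> {}" by fact
    have S: "x \<in> insert Apex C" if "x \<in> S" for x
      using that \<open>S \<subseteq> C\<close> by blast
    show "\<And>x y. \<lbrakk>x \<in> S; y \<in> S\<rbrakk> \<Longrightarrow> leads x y w \<or> leads y x w"
      by (rule total[OF S S])
    show "\<And>x y z. \<lbrakk>x \<in> S; y \<in> S; z \<in> S; leads x y w; leads y z w\<rbrakk> \<Longrightarrow> leads x z w"
      by (rule trans[OF S S S])
  qed
  \<comment> \<open>These clique vertices come after the apex in the linear order. If there are
    none, the cyclic order wraps around to a least vertex of the whole clique.\<close>
  define D where "D = {x \<in> C. leads Apex x w}"
  \<comment> \<open>the clique vertex that follows the apex in cyclic order\<close>
  obtain m where m: "m \<in> C" and empty: "\<And>x. \<lbrakk>D = {}; x \<in> C\<rbrakk> \<Longrightarrow> leads m x w"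
    and nonempty: "D \<noteq> {} \<Longrightarrow> m \<in> D" "\<And>x. x \<in> D \<Longrightarrow> leads m x w"
  proof (cases "D = {}")
    case True
    have "C \<noteq> {}" using k by (simp add: C_def)
    with least[of C] obtain m where "m \<in> C" "\<forall>x\<in>C. leads m x w" by auto
    with True show thesis by (intro that[of m]) simp_all
  next
    case False
    have "D \<subseteq> C" by (auto simp: D_def)
    with least[of D] False obtain m where "m \<in> D" "\<forall>x\<in>D. leads m x w" by auto
    with \<open>D \<subseteq> C\<close> False show thesis by (intro that[of m]) auto
  qed
  \<comment> \<open>No clique vertex lies between the apex and \<open>m\<close>, so cyclically from
    \<open>m\<close> the order is \<open>m\<close>, \<open>p\<close>, \<open>q\<close>,
    \<open>Apex\<close>, or \<open>m\<close>, \<open>q\<close>, \<open>p\<close>,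
    \<open>Apex\<close> when \<open>p\<close> precedes and \<open>q\<close> follows the apex. By
    \<open>crossing\<close>, \<open>v2\<close> in the first order and \<open>v1\<close> in the
    second alternates with a letter to which it is not adjacent.\<close>
  have contra: False
    if pq: "p \<in> C" "q \<in> C" "p \<noteq> q" "p \<noteq> m" "q \<noteq> m" "leads p q w"
      and v1: "v1 \<in> pverts ?G" "v1 \<notin> insert Apex C" "(v1, m) \<in> parcs ?G" "(v1, p) \<in> parcs ?G"
        "(v1, q) \<notin> parcs ?G" "(v1, Apex) \<notin> parcs ?G"
      and v2: "v2 \<in> pverts ?G" "v2 \<notin> insert Apex C" "(v2, m) \<in> parcs ?G" "(v2, q) \<in> parcs ?G"
        "(v2, p) \<notin> parcs ?G" "(v2, Apex) \<notin> parcs ?G"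
    for p q v1 v2
  proof -
    have V: "Apex \<in> pverts ?G" "x \<in> C \<Longrightarrow> x \<in> pverts ?G" for x
      by (auto simp: C_def pverts_A_graph pverts_K_triangle)
    let ?alt = "\<lambda>x y. leads x y w \<or> leads y x w"
    have alt: "?alt v x \<longleftrightarrow> (v, x) \<in> parcs ?G"
      if "v \<in> pverts ?G" "v \<notin> insert Apex C" "x \<in> insert Apex C" for v x
      using that V by (intro w) auto
    have a1: "?alt v1 m" "?alt v1 p" "\<not> ?alt v1 q" "\<not> ?alt v1 Apex"
      using alt[OF v1(1,2)] v1(3-) pq(1,2) m by simp_all
    have a2: "?alt v2 m" "?alt v2 q" "\<not> ?alt v2 p" "\<not> ?alt v2 Apex"
      using alt[OF v2(1,2)] v2(3-) pq(1,2) m by simp_all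
    have K: "m \<in> insert Apex C" "p \<in> insert Apex C" "q \<in> insert Apex C" "Apex \<in> insert Apex C"
      using m pq(1,2) by simp_all
    show False
    proof (cases "D = {}")
      case True
      have "x \<notin> D" for x using True by simp
      then have "leads q Apex w" "leads m Apex w"
        using m pq(2) total[OF K(3,4)] total[OF K(1,4)] by (simp_all add: D_def)
      moreover have "leads m p w"
        by (rule empty[OF True pq(1)])
      ultimately show False
        using crossing(1)[of m p w q Apex v2] pq(6) a2 by blast
    next
      case False
      have mD: "leads Apex m w"
        using nonempty(1)[OF False] by (simp add: D_def)
      have nD: "p \<notin> D \<Longrightarrow> leads p Apex w" "q \<notin> D \<Longrightarrow> leads q Apex w"
        using pq(1,2) total[OF K(2,4)] total[OF K(3,4)] by (simp_all add: D_def)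
      have D: "p \<in> D \<Longrightarrow> leads Apex p w" "q \<in> D \<Longrightarrow> leads Apex q w"
        by (simp_all add: D_def)
      consider "p \<in> D" "q \<in> D" | "p \<notin> D" "q \<notin> D" | "p \<in> D" "q \<notin> D" | "p \<notin> D" "q \<in> D"
        by blast
      then show False
      proof cases
        case 1
        then show False
          using crossing(2)[of Apex m w p q v2] pq(6) a2 mD D nonempty(2) by blast
      next
        case 2
        then have "leads p m w" using trans[OF K(2,4,1)] nD mD by blast
        with 2 show False
          using crossing(2)[of p q w Apex m v2] pq(6) a2 mD nD by blast
      next
        case 3
        then have "leads q p w" using trans[OF K(3,4,2)] nD D by blast
        with 3 show False
          using crossing(1)[of q Apex w m p v2] a2 mD nD nonempty(2) by blast
      next
        case 4
        then show False
          using crossing(1)[of p Apex w m q v1] pq(6) a1 mD nD nonempty(2) by blast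
      qed
    qed
  qed
  obtain i where i: "i \<in> {1..k}" "m = Clique i" using m by (auto simp: C_def)
  \<comment> \<open>The neighbours of \<open>m\<close> on the clique cycle are its predecessor
    \<open>r\<close> and successor \<open>s\<close>. \<open>Outer r\<close> joins \<open>m\<close>
    to \<open>r\<close> and \<open>Outer i\<close> joins \<open>m\<close> to \<open>s\<close>; they
    serve as \<open>v1\<close> and \<open>v2\<close>, in the order decided by which of
    \<open>r\<close>, \<open>s\<close> leads the other.\<close>
  obtain r where r: "r \<in> {1..k}" "i = cyc_suc k r"
    by (rule that[of "if i = 1 then k else i - 1"]) (use i(1) k in \<open>auto split: if_splits\<close>)
  obtain s where s: "s \<in> {1..k}" "s = cyc_suc k i"
    by (rule that[of "cyc_suc k i"]) (use i(1) k in auto)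
  \<comment> \<open>Here \<open>k \<ge> 3\<close> separates the predecessor from the
    successor.\<close>
  have ne: "r \<noteq> i" "s \<noteq> i" "r \<noteq> s"
    using r s i(1) k by (auto split: if_splits)
  have C: "Clique r \<in> C" "Clique s \<in> C" "Outer j \<notin> insert Apex C" for j
    using r(1) s(1) by (auto simp: C_def)
  have V: "Outer i \<in> pverts ?G" "Outer r \<in> pverts ?G"
    using i(1) r(1) by (auto simp: pverts_A_graph pverts_K_triangle)
  have outer: "(Outer j, Clique j') \<in> parcs ?G \<longleftrightarrow> j \<in> {1..k} \<and> (j' = j \<or> j' = cyc_suc k j)"
    "(Outer j, Apex) \<notin> parcs ?G" for j j'
    using k parcs_A_graph(2)[of k j j'] parcs_A_graph(8)[of j k] by simp_all
  have arcs: "(Outer i, m) \<in> parcs ?G" "(Outer i, Clique s) \<in> parcs ?G" "(Outer i, Clique r) \<notin> parcs ?G"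
    "(Outer r, m) \<in> parcs ?G" "(Outer r, Clique r) \<in> parcs ?G" "(Outer r, Clique s) \<notin> parcs ?G"
    unfolding i(2) outer using i(1) r s ne by blast+
  have "Clique r \<noteq> m" "Clique s \<noteq> m" "Clique r \<noteq> Clique s"
    using i(2) ne by simp_all
  then show False
    using total[of "Clique r" "Clique s"] C V arcs outer(2)
      contra[of "Clique r" "Clique s" "Outer r" "Outer i"]
      contra[of "Clique s" "Clique r" "Outer i" "Outer r"]
    by (metis insertI2)
qed

section \<open>Representability after deleting a vertex\<close>

text \<open>The word has four occurrences of each letter, in time blocks of length \<open>12k\<close>. It represents
  the acyclic orientation with \<open>1 \<rightarrow> \<dots> \<rightarrow> k\<close>, with \<open>1 \<rightarrow> k' \<rightarrow> k\<close>, and with each other \<open>i'\<close> a sink. The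
  last two blocks are linear extensions that put every incomparable pair in both orders. In the first two blocks every \<open>i'\<close> with \<open>i < k\<close> is delayed
  as long as possible, which breaks the alternation of the nonadjacent comparable pairs. The
  residues modulo 4 keep the times distinct.\<close>

fun occ :: "nat \<Rightarrow> vertex \<Rightarrow> nat \<Rightarrow> nat" where
  "occ k (Clique j) n = 4 * (3 * k * n + j)"
| "occ k (Outer i) n =
    (if i = k then (if n = 3 then 4 * (10 * k - 1) + 3 else 4 * (3 * k * n + 1) + 1)
     else if n = 0 then 4 * (3 * k + i - 1) + 2
     else if n = 1 then 4 * (4 * k + i) + 2
     else if n = 2 then 4 * (8 * k - i) + 2
     else 4 * (9 * k + i + 1) + 2)"
| "occ k Apex n = 0"

lemma less_4_cases: "(n::nat) < 4 \<longleftrightarrow> n = 0 \<or> n = 1 \<or> n = 2 \<or> n = 3"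
  by auto

lemma interleave_4:
  "interleave p 4 x y \<longleftrightarrow> p x 0 < p y 0 \<and> p x 1 < p y 1 \<and> p x 2 < p y 2 \<and> p x 3 < p y 3 \<and>
     p y 0 < p x 1 \<and> p y 1 < p x 2 \<and> p y 2 < p x 3"
proof -
  have "Suc n < 4 \<longleftrightarrow> n = 0 \<or> n = 1 \<or> n = 2" for n
    by auto
  then show ?thesis
    unfolding interleave_def less_4_cases by (auto simp: numeral_2_eq_2 numeral_3_eq_3)
qed

text \<open>Through \<open>word_of_times\<close>, adjacency becomes a comparison of times that are
  linear in the vertex index and \<open>k\<close>, since the occurrence number takes only four
  values.\<close>

lemma word_representable_K_triangle:
  assumes k: "k \<ge> 3"
  shows "word_representable (with_proj (K_triangle k))"
proof -
  let ?V = "pverts (K_triangle k)"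
  have V: "Clique a \<in> ?V \<longleftrightarrow> 1 \<le> a \<and> a \<le> k" "Outer a \<in> ?V \<longleftrightarrow> 1 \<le> a \<and> a \<le> k" "Apex \<notin> ?V" for a
    by (auto simp: pverts_K_triangle)
  have CC: "a = b" if "occ k (Clique a) i = occ k (Clique b) j"
    "1 \<le> a" "a \<le> k" "1 \<le> b" "b \<le> k" "i < 4" "j < 4" for a b i j
    using that(6,7,1) unfolding less_4_cases
    by (elim disjE) (use that(2-5) k in auto)
  have OO: "a = b" if "occ k (Outer a) i = occ k (Outer b) j"
    "1 \<le> a" "a < k" "1 \<le> b" "b < k" "i < 4" "j < 4" for a b i j
    using that(6,7,1) unfolding less_4_cases
    by (elim disjE) (use that(2-5) k in auto)
  \<comment> \<open>Residues separate three kinds of vertices: 0 for the clique, 2 for the outer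
    vertices other than \<open>Outer k\<close>, and 1 or 3 for \<open>Outer k\<close>.\<close>
  have mod_4: "(4 * q + c) mod 4 = c mod 4" for q c :: nat
    by simp
  have mod_C: "occ k (Clique a) i mod 4 = 0" for a i
    by simp
  have mod_O: "occ k (Outer a) i mod 4 = 2" if "a \<noteq> k" for a i
    using that by (simp only: occ.simps mod_4 split: if_split) simp
  have mod_k: "occ k (Outer k) i mod 4 = 1 \<or> occ k (Outer k) i mod 4 = 3" for i
    by (simp only: occ.simps mod_4 split: if_split) simp
  have inj: "x = y" if x: "x \<in> ?V" and y: "y \<in> ?V" and "i < 4" "j < 4" "occ k x i = occ k y j"
    for x y i j
  proof (cases x)
    case (Clique a)
    note x' = this
    show ?thesis
    proof (cases y)
      case (Clique b)
      then show ?thesis using CC[of a i b j] that x' by (simp only: V)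
    next
      case (Outer b)
      then show ?thesis using mod_C[of a i] mod_O[of b j] mod_k[of j] that(5) x'
        by (cases "b = k") (auto simp del: occ.simps)
    qed (use y V in simp)
  next
    case (Outer a)
    note x' = this
    show ?thesis
    proof (cases y)
      case (Clique b)
      then show ?thesis using mod_C[of b j] mod_O[of a i] mod_k[of i] that(5) x'
        by (cases "a = k") (auto simp del: occ.simps)
    next
      case (Outer b)
      then show ?thesis
        using OO[of a i b j] mod_O[of a i] mod_O[of b j] mod_k[of i] mod_k[of j] that x'
        by (cases "a = k"; cases "b = k") (auto simp: V le_less simp del: occ.simps)
    qed (use y V in simp)
  qed (use x V in simp)
  have mono: "occ k x i < occ k x (Suc i)" if "x \<in> ?V" "Suc i < 4" for x i
  proof -
    have "i = 0 \<or> i = 1 \<or> i = 2" using that by auto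
    then show ?thesis using that(1) k by (cases x) (auto simp: V)
  qed
  obtain w where w: "set w = ?V"
    "\<And>x y. \<lbrakk>x \<in> ?V; y \<in> ?V\<rbrakk> \<Longrightarrow> leads x y w \<longleftrightarrow> x = y \<or> interleave (occ k) 4 x y"
  proof (rule word_of_times[of ?V 4 "occ k"])
    show "finite ?V" by (simp add: pverts_K_triangle)
    show "\<And>x y i j. \<lbrakk>x \<in> ?V; y \<in> ?V; i < 4; j < 4; occ k x i = occ k y j\<rbrakk> \<Longrightarrow> x = y"
      by (rule inj)
    show "\<And>x i. \<lbrakk>x \<in> ?V; Suc i < 4\<rbrakk> \<Longrightarrow> occ k x i < occ k x (Suc i)"
      by (rule mono)
  qed (use that in simp_all)
  have sym: "(Outer a, Clique b) \<in> parcs (K_triangle k) \<longleftrightarrow> (Clique b, Outer a) \<in> parcs (K_triangle k)" for a b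
    using k by (simp add: parcs_K_triangle)
  \<comment> \<open>For \<open>b < k\<close> the first occurrence of \<open>Outer b\<close>, just
    before the second one of \<open>Clique b\<close>, forces \<open>a \<ge> b\<close>; the last one,
    just after that of \<open>Clique (b + 1)\<close>, forces \<open>a \<le> b + 1\<close>.
    \<open>Outer k\<close> follows \<open>Clique 1\<close> in three blocks but comes between
    \<open>Clique (k - 1)\<close> and \<open>Clique k\<close> in the last, which rules out the
    clique vertices strictly between 1 and \<open>k\<close>.\<close>
  have CO: "interleave (occ k) 4 (Clique a) (Outer b) \<or> interleave (occ k) 4 (Outer b) (Clique a) \<longleftrightarrow>
      (Clique a, Outer b) \<in> parcs (K_triangle k)"
    if "1 \<le> a" "a \<le> k" "1 \<le> b" "b \<le> k" for a b
    using that k by (cases "b = k") (auto simp: parcs_K_triangle interleave_4)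
  \<comment> \<open>Two outer vertices other than \<open>Outer k\<close> appear in opposite orders
    at their third and fourth occurrences. \<open>Outer k\<close> starts first, but to lead
    \<open>Outer b\<close> it would need \<open>b = 1\<close> at its second occurrence and
    \<open>b = k - 1\<close> at its last; hence the split at index 1.\<close>
  have OO_not: "\<not> interleave (occ k) 4 (Outer a) (Outer b)"
    if "1 \<le> a" "a \<le> k" "1 \<le> b" "b \<le> k" "a \<noteq> b" for a b
  proof -
    have "a = 1 \<or> 2 \<le> a" "b = 1 \<or> 2 \<le> b" using that by auto
    then show ?thesis
      using that k by (elim disjE; cases "a = k"; cases "b = k") (auto simp: interleave_4)
  qed
  have "interleave (occ k) 4 x y \<or> interleave (occ k) 4 y x \<longleftrightarrow> (x, y) \<in> parcs (K_triangle k)"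
    if xy: "x \<in> ?V" "y \<in> ?V" "x \<noteq> y" for x y
  proof (cases x)
    case (Clique a)
    note x' = this
    show ?thesis
    proof (cases y)
      case (Clique b)
      then show ?thesis using xy x' k by (auto simp: V parcs_K_triangle interleave_4)
    next
      case (Outer b)
      then show ?thesis using CO xy x' by (simp only: V)
    qed (use xy V in simp)
  next
    case (Outer a)
    note x' = this
    show ?thesis
    proof (cases y)
      case (Clique b)
      then show ?thesis using CO[of b a] sym[of a b] xy x' by (simp only: V) blast
    next
      case (Outer b)
      then show ?thesis
        using OO_not[of a b] OO_not[of b a] xy x' by (auto simp only: V parcs_K_triangle)
    qed (use xy V in simp)
  qed (use xy V in simp)
  then have "\<forall>x\<in>?V. \<forall>y\<in>?V. x \<noteq> y \<longrightarrow>
      alternate x y w = ((x, y) \<in> parcs (K_triangle k))"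
    using w(2) by (simp add: alternate_iff_leads)
  with w(1) show ?thesis
    by (auto simp: word_representable_def)
qed

lemma word_representable_A_graph_del_Apex:
  assumes "k \<ge> 3"
  shows "word_representable (pre_digraph.del_vert (with_proj (A_graph (Suc k))) Apex)"
proof (rule word_representable_embed[where h = id, OF word_representable_K_triangle[OF assms]])
  fix x y
  assume "x \<in> verts (pre_digraph.del_vert (with_proj (A_graph (Suc k))) Apex)"
    "y \<in> verts (pre_digraph.del_vert (with_proj (A_graph (Suc k))) Apex)" "x \<noteq> y"
  then show "x \<rightarrow>\<^bsub>pre_digraph.del_vert (with_proj (A_graph (Suc k))) Apex\<^esub> y \<longleftrightarrow>
      id x \<rightarrow>\<^bsub>with_proj (K_triangle k)\<^esub> id y"
    using assms unfolding del_vert_dominates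
    by (cases x; cases y) (auto simp: parcs_A_graph parcs_K_triangle)
qed (auto simp: pre_digraph.del_vert_def pverts_A_graph)

text \<open>Rotate the clique so that \<open>j\<close> comes first, and insert two further clique vertices (the last
  one for the apex) before closing the cycle. The result maps \<open>A\<close> to \<open>K_triangle (k + 2)\<close> and
  loses only the edge between \<open>j\<close> and \<open>i'\<close>, where \<open>i\<close> is the predecessor of \<open>j\<close>, so it is an embedding
  once \<open>j\<close> or \<open>i'\<close> is deleted.\<close>

definition rotate_index :: "nat \<Rightarrow> nat \<Rightarrow> nat \<Rightarrow> nat" where
  "rotate_index k j a = Suc (if j \<le> a then a - j else a + k - j)"

fun rotation :: "nat \<Rightarrow> nat \<Rightarrow> vertex \<Rightarrow> vertex" where
  "rotation k j (Clique a) = Clique (rotate_index k j a)"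
| "rotation k j (Outer a) = Outer (rotate_index k j a)"
| "rotation k j Apex = Clique (k + 2)"

lemma word_representable_A_graph_del:
  assumes k: "k \<ge> 3" and i: "i \<in> {1..k}" and v: "v = Outer i \<or> v = Clique (cyc_suc k i)"
  shows "word_representable (pre_digraph.del_vert (with_proj (A_graph (Suc k))) v)"
proof -
  let ?H = "pre_digraph.del_vert (with_proj (A_graph (Suc k))) v"
  define j where "j = cyc_suc k i"
  define r where "r = rotate_index k j"
  have j: "1 \<le> j" "j \<le> k"
    using i k by (auto simp: j_def)
  have range: "1 \<le> r a" "r a \<le> k" if "a \<in> {1..k}" for a
    using that j by (auto simp: r_def rotate_index_def)
  have inj: "r a = r b \<longleftrightarrow> a = b" if "a \<in> {1..k}" "b \<in> {1..k}" for a b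
    using that j by (auto simp: r_def rotate_index_def)
  have r_i: "r i = k"
    using i k by (auto simp: r_def rotate_index_def j_def)
  have suc: "cyc_suc k a \<in> {1..k}" "a \<noteq> i \<Longrightarrow> r (cyc_suc k a) = Suc (r a)" if "a \<in> {1..k}" for a
    using that i k by (auto simp: r_def rotate_index_def j_def)
  have V: "Clique a \<in> verts ?H \<longleftrightarrow> a \<in> {1..k} \<and> v \<noteq> Clique a"
    "Outer a \<in> verts ?H \<longleftrightarrow> a \<in> {1..k} \<and> v \<noteq> Outer a" for a
    by (auto simp: pre_digraph.del_vert_def pverts_A_graph pverts_K_triangle)
  have OC: "b = a \<or> b = cyc_suc k a \<longleftrightarrow> r b = r a \<or> r b = cyc_suc (k + 2) (r a)"
    if a: "a \<in> {1..k}" "v \<noteq> Outer a" and b: "b \<in> {1..k}" "v \<noteq> Clique b" for a b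
  proof -
    have k2: "cyc_suc (k + 2) (r a) = Suc (r a)"
      using range(2)[OF a(1)] by simp
    show ?thesis
    proof (cases "a = i")
      case True
      then have "b \<noteq> cyc_suc k a" "r b \<noteq> Suc (r a)"
        using v a(2) b range(2)[OF b(1)] r_i by auto
      with k2 inj[OF b(1) a(1)] show ?thesis by metis
    next
      case False
      with k2 inj[OF b(1) a(1)] inj[OF b(1) suc(1)[OF a(1)]] suc(2)[OF a(1)] show ?thesis by metis
    qed
  qed
  show ?thesis
  proof (rule word_representable_embed[where h = "rotation k j"])
    show "word_representable (with_proj (K_triangle (k + 2)))"
      using k by (intro word_representable_K_triangle) simp
    have dom: "x = Apex \<or> (\<exists>a\<in>{1..k}. x = Clique a \<or> x = Outer a)" if "x \<in> verts ?H" for x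
      using that by (auto simp: pre_digraph.del_vert_def pverts_A_graph pverts_K_triangle)
    have rot: "rotation k j (Clique a) = Clique (r a)" "rotation k j (Outer a) = Outer (r a)"
      "rotation k j Apex = Clique (Suc (Suc k))" for a
      by (simp_all add: r_def)
    have ran: "r a \<in> {1..k + 2}" if "a \<in> {1..k}" for a
      using range[OF that] by simp
    have ne: "r a \<noteq> Suc (Suc k)" if "a \<in> {1..k}" for a
      using range[OF that] by simp
    show "inj_on (rotation k j) (verts ?H)"
    proof (rule inj_onI)
      fix x y assume *: "x \<in> verts ?H" "y \<in> verts ?H" "rotation k j x = rotation k j y"
      show "x = y"
        using dom[OF *(1)] dom[OF *(2)] *(3)
        by (elim disjE bexE) (simp_all add: rot inj ne ne[symmetric] del: rotation.simps)
    qed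
    show "rotation k j ` verts ?H \<subseteq> verts (with_proj (K_triangle (k + 2)))"
    proof
      fix y assume "y \<in> rotation k j ` verts ?H"
      then obtain x where x: "x \<in> verts ?H" "y = rotation k j x" by blast
      show "y \<in> verts (with_proj (K_triangle (k + 2)))"
        using dom[OF x(1)] x(2) ran by (auto simp: pverts_K_triangle rot simp del: rotation.simps)
    qed
    fix x y
    assume x: "x \<in> verts ?H" and y: "y \<in> verts ?H" and "x \<noteq> y"
    have "x \<noteq> v" "y \<noteq> v"
      using x y by (auto simp: pre_digraph.del_vert_def)
    moreover have "(x, y) \<in> parcs (A_graph (Suc k)) \<longleftrightarrow>
        (rotation k j x, rotation k j y) \<in> parcs (K_triangle (k + 2))"
    proof (cases x)
      case (Clique a)
      note x' = this
      have a: "a \<in> {1..k}" "v \<noteq> Clique a"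
        using x[unfolded Clique V] by blast+
      show ?thesis
      proof (cases y)
        case (Clique b)
        have b: "b \<in> {1..k}"
          using y[unfolded Clique V] by blast+
        show ?thesis
          using a(1) b ran[OF a(1)] ran[OF b] inj[OF a(1) b]
          by (simp add: x' Clique rot parcs_A_graph parcs_K_triangle del: rotation.simps)
      next
        case (Outer b)
        have b: "b \<in> {1..k}" "v \<noteq> Outer b"
          using y[unfolded Outer V] by blast+
        show ?thesis
          using b ran[OF b(1)] OC[OF b a] k
          by (simp only: x' Outer rot parcs_A_graph(3) parcs_K_triangle(3))
      next
        case Apex
        show ?thesis
          using a ran[OF a(1)] ne[OF a(1)]
          by (simp add: x' Apex parcs_A_graph parcs_K_triangle rot del: rotation.simps)
      qed
    next
      case (Outer a)
      note x' = this
      have a: "a \<in> {1..k}" "v \<noteq> Outer a"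
        using x[unfolded Outer V] by blast+
      show ?thesis
      proof (cases y)
        case (Clique b)
        have b: "b \<in> {1..k}" "v \<noteq> Clique b"
          using y[unfolded Clique V] by blast+
        show ?thesis
          using a ran[OF a(1)] OC[OF a b] k
          by (simp only: x' Clique rot parcs_A_graph(2) parcs_K_triangle(2))
      next
        case (Outer b)
        then show ?thesis by (simp add: x' parcs_A_graph parcs_K_triangle)
      next
        case Apex
        \<comment> \<open>The only outer neighbours of \<open>Clique (k + 2)\<close> are
          \<open>Outer (k + 1)\<close> and \<open>Outer (k + 2)\<close>, both outside the image of
          the rotation.\<close>
        show ?thesis
          using range[OF a(1)] by (simp add: x' Apex parcs_A_graph parcs_K_triangle rot del: rotation.simps)
      qed
    next
      case Apex
      note x' = this
      show ?thesis
      proof (cases y)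
        case (Clique b)
        have b: "b \<in> {1..k}"
          using y[unfolded Clique V] by blast+
        then show ?thesis
          using ran[OF b] ne[OF b]
          by (simp add: x' Clique parcs_A_graph parcs_K_triangle rot del: rotation.simps)
      next
        case (Outer b)
        have b: "b \<in> {1..k}"
          using y[unfolded Outer V] by blast+
        then show ?thesis
          using range[OF b] by (simp add: x' Outer parcs_A_graph parcs_K_triangle rot del: rotation.simps)
      next
        case Apex
        then show ?thesis using \<open>x \<noteq> y\<close> x' by simp
      qed
    qed
    ultimately show "x \<rightarrow>\<^bsub>?H\<^esub> y \<longleftrightarrow> rotation k j x \<rightarrow>\<^bsub>with_proj (K_triangle (k + 2))\<^esub> rotation k j y"
      unfolding del_vert_dominates by simp
  qed
qed

theorem theorem11:
  fixes l :: nat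
  assumes "l \<ge> 4"
  shows "minimal_non_word_representable (with_proj (A_graph l))"
proof -
  obtain k where l: "l = Suc k" and k: "k \<ge> 3"
    using assms by (cases l) auto
  have "word_representable (pre_digraph.del_vert (with_proj (A_graph l)) v)"
    if "v \<in> verts (with_proj (A_graph l))" for v
  proof (cases v)
    case (Clique j)
    then have j: "j \<in> {1..k}"
      using that by (auto simp: l pverts_A_graph pverts_K_triangle)
    \<comment> \<open>The gap for the apex is opened between \<open>j\<close> and its cyclic
      predecessor \<open>i\<close>.\<close>
    obtain i where i: "i \<in> {1..k}" "j = cyc_suc k i"
      by (rule that[of "if j = 1 then k else j - 1"]) (use j k in \<open>auto split: if_splits\<close>)
    show ?thesis
      unfolding l by (rule word_representable_A_graph_del[OF k i(1)]) (use Clique i(2) in simp)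
  next
    case (Outer i)
    then show ?thesis
      using word_representable_A_graph_del[OF k, of i] that
      by (auto simp: l pverts_A_graph pverts_K_triangle)
  next
    case Apex
    then show ?thesis
      using word_representable_A_graph_del_Apex[OF k] by (simp add: l)
  qed
  then show ?thesis
    unfolding minimal_non_word_representable_def l
    using not_word_representable_A_graph[OF k] by blast
qed

end
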